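(* Let $g,k\geq 2$ be integers, let $(S,H)$ be a $(g,k)$-Fermat pair, put $X=S/H$, and let $\pi:S\to X$ be a Galois covering with deck group $H$. Write $H=\langle a_{1},\ldots,a_{2g}\rangle\cong\mathbb{Z}_{k}^{2g}$ and, for $j=1,\ldots,2g$, let $K_{j}\cong\mathbb{Z}_{k}^{2g-1}$ be the subgroup generated by $\{a_{1},\ldots,a_{j-1},a_{j+1},\ldots,a_{2g}\}$. Set $Y_{j}=S/K_{j}$, let $Q_{j}:S\to Y_{j}$ be a Galois covering with deck group $K_{j}$, and let $P_{j}:Y_{j}\to X$ be a cyclic covering with deck group $H/K_{j}\cong\mathbb{Z}_{k}$ such that $\pi=P_{j}\circ Q_{j}$. Then $(S,H)$ is the fiber product of the $2g$ pairs $(Y_{j},P_{j}:Y_{j}\to X)$, $j=1,\ldots,2g$.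
   Context: For integers $g,k\geq 2$, a $(g,k)$-Fermat pair is a pair $(S,H)$ where $S$ is a closed Riemann surface and $H\leq \mathrm{Aut}(S)$ (the group of conformal automorphisms of $S$) satisfies $H\cong\mathbb{Z}_{k}^{2g}$, acts freely on $S$, and $S/H$ has genus $g$. Given coverings $P_{j}:Y_{j}\to X$, $j=1,\ldots,2g$, their fiber product is $$Z=\{(y_{1},\ldots,y_{2g})\in Y_{1}\times\cdots\times Y_{2g}: P_{1}(y_{1})=P_{2}(y_{2})=\cdots=P_{2g}(y_{2g})\},$$ with the projection $P:Z\to X$, $P(y_1,\ldots,y_{2g})=P_{1}(y_{1})$, and the group $J=C_{1}\times\cdots\times C_{2g}$, where $C_{j}=H/K_{j}$ is the deck group of $P_{j}$, acting coordinatewise on $Z$. Saying that $(S,H)$ is the fiber product of the pairs $(Y_{j},P_{j})$ means that $Z$ is a connected closed Riemann surface and $(S,H)$ and $(Z,J)$ are isomorphic, i.e. there is a biholomorphism $\varphi:S\to Z$ with $\varphi H\varphi^{-1}=J$. *)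

theory Defs
  imports
    "HOL-Complex_Analysis.Complex_Analysis"
    "HOL-Homology.Homology"
    "HOL-Algebra.Bij"
    "HOL-Algebra.Product_Groups"
begin

section \<open>Riemann surfaces\<close>

text \<open>
  The underlying set is the topspace of \<open>surf_top\<close>.  A chart is a pair \<open>(U, f)\<close>
  of an open set and a coordinate on it; only the values of \<open>f\<close> on \<open>U\<close> matter.
\<close>

record 'a surface =
  surf_top :: "'a topology"
  surf_charts :: "('a set \<times> ('a \<Rightarrow> complex)) set"

abbreviation points :: "'a surface \<Rightarrow> 'a set"
  where "points S \<equiv> topspace (surf_top S)"

definition coordinate_chart :: "'a topology \<Rightarrow> 'a set \<Rightarrow> ('a \<Rightarrow> complex) \<Rightarrow> bool"
  where "coordinate_chart T U f \<longleftrightarrow>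
    openin T U \<and> open (f ` U) \<and>
    homeomorphic_map (subtopology T U) (top_of_set (f ` U)) f"

definition riemann_surface :: "'a surface \<Rightarrow> bool"
  where "riemann_surface S \<longleftrightarrow>
    points S \<noteq> {} \<and> connected_space (surf_top S) \<and> Hausdorff_space (surf_top S) \<and>
    (\<forall>(U, f) \<in> surf_charts S. coordinate_chart (surf_top S) U f) \<and>
    (\<Union>(U, f) \<in> surf_charts S. U) = points S \<and>
    (\<forall>(U, f) \<in> surf_charts S. \<forall>(V, h) \<in> surf_charts S.
        (h \<circ> inv_into U f) holomorphic_on f ` (U \<inter> V))"

text \<open>Second countability is not required: for compact surfaces it is automatic.\<close>

definition closed_riemann_surface :: "'a surface \<Rightarrow> bool"
  where "closed_riemann_surface S \<longleftrightarrow> riemann_surface S \<and> compact_space (surf_top S)"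

definition holomorphic_map :: "'a surface \<Rightarrow> 'b surface \<Rightarrow> ('a \<Rightarrow> 'b) \<Rightarrow> bool"
  where "holomorphic_map S T p \<longleftrightarrow>
    continuous_map (surf_top S) (surf_top T) p \<and>
    (\<forall>(U, f) \<in> surf_charts S. \<forall>(V, h) \<in> surf_charts T.
        (h \<circ> p \<circ> inv_into U f) holomorphic_on f ` {x \<in> U. p x \<in> V})"

definition biholomorphic_map :: "'a surface \<Rightarrow> 'b surface \<Rightarrow> ('a \<Rightarrow> 'b) \<Rightarrow> bool"
  where "biholomorphic_map S T p \<longleftrightarrow>
    bij_betw p (points S) (points T) \<and>
    holomorphic_map S T p \<and> holomorphic_map T S (inv_into (points S) p)"

text \<open>
  Conformal automorphisms, represented (as in \<^const>\<open>BijGroup\<close>) by functions that are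
  \<open>undefined\<close> outside the surface, with composition as multiplication.
\<close>

definition Aut :: "'a surface \<Rightarrow> ('a \<Rightarrow> 'a) monoid"
  where "Aut S = BijGroup (points S)
    \<lparr>carrier := {f \<in> Bij (points S). biholomorphic_map S S f}\<rparr>"

definition acts_freely :: "'a surface \<Rightarrow> ('a \<Rightarrow> 'a) set \<Rightarrow> bool"
  where "acts_freely S H \<longleftrightarrow>
    (\<forall>h \<in> H. \<forall>x \<in> points S. h x = x \<longrightarrow> h = \<one>\<^bsub>Aut S\<^esub>)"

text \<open>A closed surface has genus \<open>g\<close> iff its first integral homology is free of rank \<open>2 * g\<close>.\<close>

definition has_genus :: "'a topology \<Rightarrow> nat \<Rightarrow> bool"
  where "has_genus T g \<longleftrightarrow>
    homology_group 1 T \<cong> product_group {1..2 * g} (\<lambda>_. integer_group)"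


section \<open>Orbit spaces and Fermat pairs\<close>

definition orbit :: "('a \<Rightarrow> 'a) set \<Rightarrow> 'a \<Rightarrow> 'a set"
  where "orbit H x = (\<lambda>h. h x) ` H"

definition orbit_open :: "'a topology \<Rightarrow> ('a \<Rightarrow> 'a) set \<Rightarrow> 'a set set \<Rightarrow> bool"
  where "orbit_open T H W \<longleftrightarrow>
    W \<subseteq> orbit H ` topspace T \<and> openin T {x \<in> topspace T. orbit H x \<in> W}"

definition orbit_space :: "'a topology \<Rightarrow> ('a \<Rightarrow> 'a) set \<Rightarrow> 'a set topology"
  where "orbit_space T H = topology (orbit_open T H)"

lemma openin_orbit_space: "openin (orbit_space T H) W \<longleftrightarrow> orbit_open T H W"
proof -
  have "istopology (orbit_open T H)"
    unfolding istopology_def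
  proof (intro conjI allI impI)
    fix V W assume "orbit_open T H V" "orbit_open T H W"
    moreover have "{x \<in> topspace T. orbit H x \<in> V \<inter> W} =
        {x \<in> topspace T. orbit H x \<in> V} \<inter> {x \<in> topspace T. orbit H x \<in> W}"
      by auto
    ultimately show "orbit_open T H (V \<inter> W)"
      unfolding orbit_open_def by auto
  next
    fix \<W> assume \<W>: "\<forall>W \<in> \<W>. orbit_open T H W"
    have "{x \<in> topspace T. orbit H x \<in> \<Union>\<W>} =
        (\<Union>W \<in> \<W>. {x \<in> topspace T. orbit H x \<in> W})"
      by auto
    moreover have "openin T (\<Union>W \<in> \<W>. {x \<in> topspace T. orbit H x \<in> W})"
      using \<W> unfolding orbit_open_def by (intro openin_Union) auto
    ultimately show "orbit_open T H (\<Union>\<W>)"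
      using \<W> unfolding orbit_open_def by auto
  qed
  then show ?thesis
    unfolding orbit_space_def by (simp add: topology_inverse')
qed

lemma topspace_orbit_space: "topspace (orbit_space T H) = orbit H ` topspace T"
proof -
  have "{x \<in> topspace T. orbit H x \<in> orbit H ` topspace T} = topspace T"
    by auto
  then have "openin (orbit_space T H) (orbit H ` topspace T)"
    unfolding openin_orbit_space orbit_open_def by simp
  moreover have "topspace (orbit_space T H) \<subseteq> orbit H ` topspace T"
    by (metis openin_orbit_space openin_topspace orbit_open_def)
  ultimately show ?thesis
    by (metis openin_subset subset_antisym)
qed

lemma quotient_map_orbit: "quotient_map T (orbit_space T H) (orbit H)"
  unfolding quotient_map_def topspace_orbit_space openin_orbit_space orbit_open_def
  by auto

definition fermat_pair :: "nat \<Rightarrow> nat \<Rightarrow> 'a surface \<Rightarrow> ('a \<Rightarrow> 'a) set \<Rightarrow> bool"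
  where "fermat_pair g k S H \<longleftrightarrow>
    g \<ge> 2 \<and> k \<ge> 2 \<and> closed_riemann_surface S \<and>
    subgroup H (Aut S) \<and>
    (Aut S)\<lparr>carrier := H\<rparr> \<cong> product_group {1..2 * g} (\<lambda>_. integer_mod_group k) \<and>
    acts_freely S H \<and>
    has_genus (orbit_space (surf_top S) H) g"


section \<open>Galois coverings\<close>

definition covering_map :: "'a topology \<Rightarrow> 'b topology \<Rightarrow> ('a \<Rightarrow> 'b) \<Rightarrow> bool"
  where "covering_map T T' p \<longleftrightarrow>
    continuous_map T T' p \<and> p ` topspace T = topspace T' \<and>
    (\<forall>y \<in> topspace T'. \<exists>U. openin T' U \<and> y \<in> U \<and>
      (\<exists>\<V>. \<Union>\<V> = {x \<in> topspace T. p x \<in> U} \<and> pairwise disjnt \<V> \<and>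
        (\<forall>V \<in> \<V>. openin T V \<and>
          homeomorphic_map (subtopology T V) (subtopology T' U) p)))"

definition holomorphic_covering :: "'a surface \<Rightarrow> 'b surface \<Rightarrow> ('a \<Rightarrow> 'b) \<Rightarrow> bool"
  where "holomorphic_covering S X p \<longleftrightarrow>
    riemann_surface S \<and> riemann_surface X \<and> holomorphic_map S X p \<and>
    covering_map (surf_top S) (surf_top X) p"

definition deck_group :: "'a surface \<Rightarrow> ('a \<Rightarrow> 'b) \<Rightarrow> ('a \<Rightarrow> 'a) set"
  where "deck_group S p = {f \<in> carrier (Aut S). \<forall>x \<in> points S. p (f x) = p x}"

text \<open>
  The fibres of such a \<open>p\<close> are exactly the orbits of \<open>G\<close>, so \<open>X\<close>, with projection \<open>p\<close>,
  is a model of the quotient \<open>S/G\<close>; see \<open>galois_covering_orbit_space\<close> below.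
\<close>

definition galois_covering ::
    "'a surface \<Rightarrow> 'b surface \<Rightarrow> ('a \<Rightarrow> 'b) \<Rightarrow> ('a \<Rightarrow> 'a) set \<Rightarrow> bool"
  where "galois_covering S X p G \<longleftrightarrow>
    holomorphic_covering S X p \<and> G = deck_group S p \<and>
    (\<forall>x \<in> points S. \<forall>y \<in> points S. p x = p y \<longrightarrow> (\<exists>f \<in> G. f x = y))"

definition cyclic_covering ::
    "nat \<Rightarrow> 'a surface \<Rightarrow> 'b surface \<Rightarrow> ('a \<Rightarrow> 'b) \<Rightarrow> ('a \<Rightarrow> 'a) set \<Rightarrow> bool"
  where "cyclic_covering k S X p G \<longleftrightarrow>
    galois_covering S X p G \<and> (Aut S)\<lparr>carrier := G\<rparr> \<cong> integer_mod_group k"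

text \<open>
  If \<open>q\<close> is a Galois covering of \<open>Y\<close> by \<open>S\<close> with deck group a normal subgroup \<open>K\<close> of
  \<open>H\<close>, this is \<open>H/K\<close> acting on \<open>Y = S/K\<close>: the coset of \<open>h\<close> sends \<open>q x\<close> to \<open>q (h x)\<close>.
\<close>

definition quotient_action ::
    "'a surface \<Rightarrow> ('a \<Rightarrow> 'a) set \<Rightarrow> 'b surface \<Rightarrow> ('a \<Rightarrow> 'b) \<Rightarrow> ('b \<Rightarrow> 'b) set"
  where "quotient_action S H Y q =
    {f \<in> carrier (Aut Y). \<exists>h \<in> H. \<forall>x \<in> points S. f (q x) = q (h x)}"

lemma covering_map_imp_open_map:
  assumes "covering_map T T' p"
  shows "open_map T T' p"
  unfolding open_map_def
proof (intro allI impI)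
  fix W assume W: "openin T W"
  show "openin T' (p ` W)"
  proof (subst openin_subopen, intro ballI)
    fix y assume "y \<in> p ` W"
    then obtain x where x: "x \<in> W" "y = p x" by auto
    have xT: "x \<in> topspace T" using x W openin_subset by blast
    then have "y \<in> topspace T'"
      using assms x unfolding covering_map_def by auto
    then obtain U \<V> where U: "openin T' U" "y \<in> U"
      and \<V>: "\<Union>\<V> = {x \<in> topspace T. p x \<in> U}"
      and hom: "\<And>V. V \<in> \<V> \<Longrightarrow>
        openin T V \<and> homeomorphic_map (subtopology T V) (subtopology T' U) p"
      using assms unfolding covering_map_def by meson
    obtain V where V: "V \<in> \<V>" "x \<in> V"
      using \<V> U x xT by blast
    have "open_map (subtopology T V) (subtopology T' U) p"
      using hom V homeomorphic_imp_open_map by blast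
    moreover have "openin (subtopology T V) (W \<inter> V)"
      using W openin_subtopology by blast
    ultimately have "openin (subtopology T' U) (p ` (W \<inter> V))"
      unfolding open_map_def by blast
    then have "openin T' (p ` (W \<inter> V))"
      using U openin_trans_full by blast
    then show "\<exists>N. openin T' N \<and> y \<in> N \<and> N \<subseteq> p ` W"
      using x V by blast
  qed
qed

lemma galois_covering_orbit_space:
  assumes "galois_covering S X p G"
  obtains f where "homeomorphic_map (orbit_space (surf_top S) G) (surf_top X) f"
    and "\<And>x. x \<in> points S \<Longrightarrow> f (orbit G x) = p x"
proof -
  have cov: "covering_map (surf_top S) (surf_top X) p"
    and deck: "\<And>h x. h \<in> G \<Longrightarrow> x \<in> points S \<Longrightarrow> h x \<in> points S \<and> p (h x) = p x"
    and trans: "\<And>x y. x \<in> points S \<Longrightarrow> y \<in> points S \<Longrightarrow> p x = p y \<Longrightarrow> \<exists>f \<in> G. f x = y"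
    using assms
    unfolding galois_covering_def holomorphic_covering_def deck_group_def Aut_def Bij_def
    by (auto dest: bij_betwE)
  have quot: "quotient_map (surf_top S) (surf_top X) p"
    using cov covering_map_imp_open_map[OF cov] unfolding covering_map_def
    by (intro continuous_open_imp_quotient_map) auto
  have orb: "orbit G z = {w \<in> points S. p w = p z}" if z: "z \<in> points S" for z
  proof
    show "orbit G z \<subseteq> {w \<in> points S. p w = p z}"
      using deck[OF _ z] unfolding orbit_def by auto
    show "{w \<in> points S. p w = p z} \<subseteq> orbit G z"
      using trans[OF z] unfolding orbit_def by (auto simp: image_iff) metis
  qed
  have fibres: "p x = p y \<longleftrightarrow> orbit G x = orbit G y"
    if "x \<in> points S" "y \<in> points S" for x y
    using orb[OF that(1)] orb[OF that(2)] that by auto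
  obtain f where f: "continuous_map (orbit_space (surf_top S) G) (surf_top X) f"
    and fp: "\<And>x. x \<in> points S \<Longrightarrow> f (orbit G x) = p x"
    using quotient_map_lift_exists[OF quotient_map_orbit quotient_imp_continuous_map[OF quot]]
      fibres by metis
  have "quotient_map (surf_top S) (surf_top X) (f \<circ> orbit G)"
    using quotient_map_eq[OF quot] fp by simp
  then have "quotient_map (orbit_space (surf_top S) G) (surf_top X) f"
    using quotient_map_from_composition[OF quotient_imp_continuous_map[OF quotient_map_orbit] f]
    by blast
  moreover have "inj_on f (topspace (orbit_space (surf_top S) G))"
    unfolding topspace_orbit_space using fp fibres by (auto simp: inj_on_def)
  ultimately show ?thesis
    using that fp unfolding homeomorphic_map_def by blast
qed


section \<open>Fiber products\<close>

text \<open>Coordinates are indexed by \<open>1, \<dots>, n\<close>; points are functions \<open>undefined\<close> elsewhere.\<close>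

definition fiber_product_points ::
    "nat \<Rightarrow> (nat \<Rightarrow> 'b surface) \<Rightarrow> (nat \<Rightarrow> 'b \<Rightarrow> 'c) \<Rightarrow> (nat \<Rightarrow> 'b) set"
  where "fiber_product_points n Y P =
    {y \<in> \<Pi>\<^sub>E j\<in>{1..n}. points (Y j). \<forall>i \<in> {1..n}. \<forall>j \<in> {1..n}. P i (y i) = P j (y j)}"

definition fiber_product_top ::
    "nat \<Rightarrow> (nat \<Rightarrow> 'b surface) \<Rightarrow> (nat \<Rightarrow> 'b \<Rightarrow> 'c) \<Rightarrow> (nat \<Rightarrow> 'b) topology"
  where "fiber_product_top n Y P =
    subtopology (product_topology (\<lambda>j. surf_top (Y j)) {1..n}) (fiber_product_points n Y P)"

definition fiber_product_proj :: "(nat \<Rightarrow> 'b \<Rightarrow> 'c) \<Rightarrow> (nat \<Rightarrow> 'b) \<Rightarrow> 'c"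
  where "fiber_product_proj P y = P 1 (y 1)"

text \<open>
  The complex structure is lifted from \<open>X\<close>: the coordinates are those of \<open>X\<close> composed with
  the projection, on open sets that the projection maps homeomorphically onto an open set.
\<close>

definition fiber_product ::
    "nat \<Rightarrow> (nat \<Rightarrow> 'b surface) \<Rightarrow> 'c surface \<Rightarrow> (nat \<Rightarrow> 'b \<Rightarrow> 'c) \<Rightarrow> (nat \<Rightarrow> 'b) surface"
  where "fiber_product n Y X P =
    \<lparr>surf_top = fiber_product_top n Y P,
     surf_charts = {(W, f \<circ> fiber_product_proj P) | W U f.
       (U, f) \<in> surf_charts X \<and>
       openin (fiber_product_top n Y P) W \<and>
       fiber_product_proj P ` W \<subseteq> U \<and>
       openin (surf_top X) (fiber_product_proj P ` W) \<and>
       homeomorphic_map (subtopology (fiber_product_top n Y P) W)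
         (subtopology (surf_top X) (fiber_product_proj P ` W)) (fiber_product_proj P)}\<rparr>"

definition fiber_product_group ::
    "nat \<Rightarrow> (nat \<Rightarrow> 'b surface) \<Rightarrow> (nat \<Rightarrow> 'b \<Rightarrow> 'c) \<Rightarrow> ((nat \<Rightarrow> 'b) \<Rightarrow> (nat \<Rightarrow> 'b)) set"
  where "fiber_product_group n Y P =
    {\<lambda>y\<in>fiber_product_points n Y P. \<lambda>j\<in>{1..n}. c j (y j) | c.
      c \<in> (\<Pi>\<^sub>E j\<in>{1..n}. deck_group (Y j) (P j))}"

definition isomorphic_pairs ::
    "'a surface \<Rightarrow> ('a \<Rightarrow> 'a) set \<Rightarrow> 'b surface \<Rightarrow> ('b \<Rightarrow> 'b) set \<Rightarrow> bool"
  where "isomorphic_pairs S H Z J \<longleftrightarrow>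
    (\<exists>\<phi>. biholomorphic_map S Z \<phi> \<and>
      (\<lambda>h. \<lambda>z\<in>points Z. \<phi> (h (inv_into (points S) \<phi> z))) ` H = J)"

definition is_fiber_product ::
    "'a surface \<Rightarrow> ('a \<Rightarrow> 'a) set \<Rightarrow>
      nat \<Rightarrow> (nat \<Rightarrow> 'b surface) \<Rightarrow> 'c surface \<Rightarrow> (nat \<Rightarrow> 'b \<Rightarrow> 'c) \<Rightarrow> bool"
  where "is_fiber_product S H n Y X P \<longleftrightarrow>
    closed_riemann_surface (fiber_product n Y X P) \<and>
    isomorphic_pairs S H (fiber_product n Y X P) (fiber_product_group n Y P)"

end

theory Submission
  imports Defs
begin

text \<open>
  The isomorphism is \<open>\<phi> x = (Q\<^sub>1 x, \<dots>, Q\<^sub>2\<^sub>g x)\<close>.  It lands in the fiber product because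
  every \<open>P\<^sub>j (Q\<^sub>j x)\<close> equals \<open>\<pi> x\<close>.  Over a given point of \<open>X\<close>, the fibre of \<open>S\<close> is a copy of
  \<open>H\<close>, as \<open>H\<close> acts freely and is transitive on fibres, and the fibre of \<open>Y\<^sub>j\<close> is the corresponding copy
  of \<open>H/K\<^sub>j\<close>.  So \<open>\<phi>\<close> is fibrewise the map \<open>H \<rightarrow> H/K\<^sub>1 \<times> \<dots> \<times> H/K\<^sub>2\<^sub>g\<close>, and the geometric claim
  becomes the algebraic claim that this map is bijective.

  Surjectivity holds for any abelian group generated by the \<open>a\<^sub>i\<close>: modulo \<open>K\<^sub>j\<close> only the exponent of
  \<open>a\<^sub>j\<close> matters, and the exponents can be prescribed independently
  (\<open>exists_common_coset_representative\<close>).  Injectivity says that the \<open>K\<^sub>j\<close> intersect trivially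
  (\<open>homocyclic_omit_inter_trivial\<close>).  It comes from counting: the \<open>2g\<close> generators have order
  dividing \<open>k\<close> and produce \<open>k ^ (2g)\<close> elements, so the exponents are determined modulo \<open>k\<close>.

  The analysis is soft.  A continuous bijection from the compact \<open>S\<close> to the Hausdorff fiber
  product is a homeomorphism, which gives connectedness and compactness.  Both complex structures
  are pulled back from \<open>X\<close> by local homeomorphisms, and \<open>\<phi>\<close> is compatible with the projections;
  hence in charts \<open>\<phi>\<close> reads as the holomorphic map \<open>\<pi>\<close>, and its inverse is holomorphic because an
  injective holomorphic map on an open set has a holomorphic inverse
  (\<open>fiber_product_parametrization\<close>).

  The same coset argument compares the groups.  An element of \<open>H\<close> descends to a deck transformation
  of each \<open>P\<^sub>j\<close>; conversely, deck transformations of all the \<open>P\<^sub>j\<close> come from elements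
  \<open>h\<^sub>j\<close> of \<open>H\<close>, and a common representative of the cosets of the \<open>h\<^sub>j\<close> modulo \<open>K\<^sub>j\<close> induces all of
  them at once.
\<close>

section \<open>Homocyclic groups\<close>

lemma (in comm_group) finprod_int_pow_mult:
  fixes d e :: "'i \<Rightarrow> int"
  assumes "a \<in> I \<rightarrow> carrier G"
  shows "(\<Otimes>i\<in>I. a i [^] (d i + e i)) = (\<Otimes>i\<in>I. a i [^] d i) \<otimes> (\<Otimes>i\<in>I. a i [^] e i)"
proof -
  have "(\<Otimes>i\<in>I. a i [^] (d i + e i)) = (\<Otimes>i\<in>I. a i [^] d i \<otimes> a i [^] e i)"
    using assms by (intro finprod_cong') (auto simp: int_pow_mult Pi_iff)
  also have "\<dots> = (\<Otimes>i\<in>I. a i [^] d i) \<otimes> (\<Otimes>i\<in>I. a i [^] e i)"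
    using assms by (intro finprod_multf) auto
  finally show ?thesis .
qed

text \<open>
  The exponents range over all functions to the integers, without support or range conditions.
  This makes the map from exponents to elements a homomorphism, so that its image is closed under
  products; reduction modulo the exponent of the group is left to the counting argument.
\<close>

lemma (in comm_group) generate_eq_finprod_int_pow:
  fixes a :: "'i \<Rightarrow> 'a"
  assumes fin: "finite I" and a: "a \<in> I \<rightarrow> carrier G"
  shows "generate G (a ` I) = range (\<lambda>e :: 'i \<Rightarrow> int. \<Otimes>i\<in>I. a i [^] e i)"
proof (intro equalityI subsetI)
  fix x assume "x \<in> generate G (a ` I)"
  then show "x \<in> range (\<lambda>e :: 'i \<Rightarrow> int. \<Otimes>i\<in>I. a i [^] e i)"
  proof induction
    case one
    show ?case by (rule range_eqI[where x = "\<lambda>_. 0"]) simp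
  next
    case (incl h)
    then obtain j where j: "j \<in> I" "h = a j" by auto
    have "(\<Otimes>i\<in>I. a i [^] (if j = i then 1 else 0 :: int)) = (\<Otimes>i\<in>I. if j = i then a i else \<one>)"
      using a by (intro finprod_cong') (auto simp: Pi_iff)
    also have "\<dots> = h"
      using j fin a by (simp add: finprod_singleton)
    finally show ?case by (intro range_eqI[where x = "\<lambda>i. if j = i then 1 else 0"]) simp
  next
    case (inv h)
    then obtain j where j: "j \<in> I" "h = a j" by auto
    have "(\<Otimes>i\<in>I. a i [^] (if j = i then - 1 else 0 :: int))
        = (\<Otimes>i\<in>I. if j = i then inv (a i) else \<one>)"
      using a by (intro finprod_cong') (auto simp: Pi_iff int_pow_neg)
    also have "\<dots> = inv h"
      using j fin a by (subst finprod_singleton) auto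
    finally show ?case by (intro range_eqI[where x = "\<lambda>i. if j = i then - 1 else 0"]) simp
  next
    case (eng x y)
    then show ?case
      by (auto simp flip: finprod_int_pow_mult[OF a])
  qed
next
  have "(\<Otimes>i\<in>J. a i [^] e i) \<in> generate G (a ` I)" if "J \<subseteq> I" "finite J" for e :: "'i \<Rightarrow> int" and J
    using that(2,1)
  proof (induction J)
    case empty
    show ?case by (simp add: generate.one)
  next
    case (insert j J)
    have sub: "subgroup (generate G (a ` I)) G"
      using a by (intro generate_is_subgroup) auto
    have "a j \<in> generate G (a ` I)"
      using insert.prems by (auto intro: generate.incl)
    then have "a j [^] e j \<in> generate G (a ` I)"
      by (metis sub subgroup_int_pow_closed)
    moreover have "(\<Otimes>i\<in>insert j J. a i [^] e i) = a j [^] e j \<otimes> (\<Otimes>i\<in>J. a i [^] e i)"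
      using insert a by (intro finprod_insert) auto
    ultimately show ?case
      using insert sub by (auto intro: generate.eng)
  qed
  then show "x \<in> generate G (a ` I)"
    if "x \<in> range (\<lambda>e :: 'i \<Rightarrow> int. \<Otimes>i\<in>I. a i [^] e i)" for x
    using that fin by auto
qed

lemma (in comm_group) generate_omit_eq_finprod_int_pow:
  fixes a :: "'i \<Rightarrow> 'a"
  assumes "finite I" and a: "a \<in> I \<rightarrow> carrier G" and "j \<in> I"
  shows "x \<in> generate G (a ` (I - {j})) \<longleftrightarrow>
    (\<exists>e :: 'i \<Rightarrow> int. e j = 0 \<and> x = (\<Otimes>i\<in>I. a i [^] e i))"
proof -
  have drop: "(\<Otimes>i\<in>I. a i [^] e i) = (\<Otimes>i\<in>I - {j}. a i [^] e i)" if "e j = 0" for e :: "'i \<Rightarrow> int"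
    using assms that by (intro finprod_mono_neutral_cong_right) auto
  have "x \<in> generate G (a ` (I - {j})) \<longleftrightarrow> (\<exists>e :: 'i \<Rightarrow> int. x = (\<Otimes>i\<in>I - {j}. a i [^] e i))"
    using generate_eq_finprod_int_pow[of "I - {j}" a] assms by auto
  also have "\<dots> \<longleftrightarrow> (\<exists>e :: 'i \<Rightarrow> int. e j = 0 \<and> x = (\<Otimes>i\<in>I. a i [^] e i))"
  proof
    assume "\<exists>e :: 'i \<Rightarrow> int. x = (\<Otimes>i\<in>I - {j}. a i [^] e i)"
    then obtain e :: "'i \<Rightarrow> int" where "x = (\<Otimes>i\<in>I - {j}. a i [^] e i)" by blast
    also have "\<dots> = (\<Otimes>i\<in>I. a i [^] (e(j := 0)) i)"
      using a by (subst drop) (auto intro!: finprod_cong' split: if_splits)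
    finally show "\<exists>e :: 'i \<Rightarrow> int. e j = 0 \<and> x = (\<Otimes>i\<in>I. a i [^] e i)"
      by (intro exI[of _ "e(j := 0)"]) simp
  next
    assume "\<exists>e :: 'i \<Rightarrow> int. e j = 0 \<and> x = (\<Otimes>i\<in>I. a i [^] e i)"
    then obtain e :: "'i \<Rightarrow> int" where "e j = 0" "x = (\<Otimes>i\<in>I. a i [^] e i)" by auto
    then have "x = (\<Otimes>i\<in>I - {j}. a i [^] e i)" using drop by simp
    then show "\<exists>e :: 'i \<Rightarrow> int. x = (\<Otimes>i\<in>I - {j}. a i [^] e i)" by blast
  qed
  finally show ?thesis .
qed

text \<open>
  This is the surjectivity of the map to the product of the quotients by the omitting subgroups.
  Modulo the subgroup that omits \<open>a j\<close> only the exponent of \<open>a j\<close> matters, so \<open>x\<close> may take its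
  \<open>j\<close>-th exponent from \<open>h j\<close>, for all \<open>j\<close> at once.
\<close>

lemma (in comm_group) exists_common_coset_representative:
  fixes a :: "'i \<Rightarrow> 'a"
  assumes fin: "finite I" and a: "a \<in> I \<rightarrow> carrier G"
    and h: "\<And>j. j \<in> I \<Longrightarrow> h j \<in> generate G (a ` I)"
  obtains x where "x \<in> generate G (a ` I)"
    and "\<And>j. j \<in> I \<Longrightarrow> \<exists>c \<in> generate G (a ` (I - {j})). x = c \<otimes> h j"
proof -
  have "\<exists>e :: 'i \<Rightarrow> int. h j = (\<Otimes>i\<in>I. a i [^] e i)" if "j \<in> I" for j
    using h[OF that] generate_eq_finprod_int_pow[OF fin a] by auto
  then obtain e :: "'i \<Rightarrow> 'i \<Rightarrow> int" where e: "\<And>j. j \<in> I \<Longrightarrow> h j = (\<Otimes>i\<in>I. a i [^] e j i)"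
    by metis
  define x where "x = (\<Otimes>i\<in>I. a i [^] e i i)"
  show ?thesis
  proof
    show "x \<in> generate G (a ` I)"
      unfolding x_def generate_eq_finprod_int_pow[OF fin a]
      by (rule range_eqI[where x = "\<lambda>i. e i i"]) simp
    show "\<exists>c \<in> generate G (a ` (I - {j})). x = c \<otimes> h j" if j: "j \<in> I" for j
    proof
      show "(\<Otimes>i\<in>I. a i [^] (e i i - e j i)) \<in> generate G (a ` (I - {j}))"
        unfolding generate_omit_eq_finprod_int_pow[OF fin a j]
        by (intro exI[of _ "\<lambda>i. e i i - e j i"]) auto
      show "x = (\<Otimes>i\<in>I. a i [^] (e i i - e j i)) \<otimes> h j"
        unfolding x_def e[OF j] finprod_int_pow_mult[OF a, symmetric] by simp
    qed
  qed
qed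

text \<open>
  There are \<open>k ^ card I\<close> reduced exponent vectors and as many group elements.  Every element is
  reached by a reduced vector, hence by exactly one.
\<close>

lemma (in comm_group) homocyclic_exponents_unique:
  fixes d e :: "'i \<Rightarrow> int"
  assumes fin: "finite I" and a: "a \<in> I \<rightarrow> carrier G" and gen: "carrier G = generate G (a ` I)"
    and k: "k > 0" and exponent: "\<And>x. x \<in> carrier G \<Longrightarrow> x [^] k = \<one>"
    and card: "card (carrier G) = k ^ card I"
    and eq: "(\<Otimes>i\<in>I. a i [^] d i) = (\<Otimes>i\<in>I. a i [^] e i)" and j: "j \<in> I"
  shows "d j mod int k = e j mod int k"
proof -
  define E where "E = (\<Pi>\<^sub>E i\<in>I. {0..<int k})"
  define r :: "('i \<Rightarrow> int) \<Rightarrow> 'i \<Rightarrow> int" where "r e = (\<lambda>i\<in>I. e i mod int k)" for e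
  have pow_mod: "x [^] (m mod int k) = x [^] m" if x: "x \<in> carrier G" for x and m :: int
  proof -
    have "int (ord x) dvd int k"
      using exponent[OF x] pow_eq_id[OF x] by simp
    then have "int (ord x) dvd m - m mod int k"
      by (metis dvd_minus_mod dvd_trans)
    then show ?thesis
      using int_pow_eq[OF x] by simp
  qed
  have r: "r e \<in> E" "(\<Otimes>i\<in>I. a i [^] r e i) = (\<Otimes>i\<in>I. a i [^] e i)" for e
    using k a pow_mod by (auto simp: r_def E_def Pi_iff intro!: finprod_cong')
  have "(\<lambda>e. \<Otimes>i\<in>I. a i [^] e i) ` E = carrier G"
    unfolding gen generate_eq_finprod_int_pow[OF fin a]
  proof (intro equalityI, simp add: image_mono, rule image_subsetI)
    show "(\<Otimes>i\<in>I. a i [^] e i) \<in> (\<lambda>e. \<Otimes>i\<in>I. a i [^] e i) ` E" for e :: "'i \<Rightarrow> int"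
      by (rule image_eqI[where x = "r e"]) (use r in auto)
  qed
  moreover have "finite E" "card E = k ^ card I"
    unfolding E_def using fin by (auto simp: card_PiE finite_PiE)
  ultimately have "inj_on (\<lambda>e. \<Otimes>i\<in>I. a i [^] e i) E"
    using card by (intro eq_card_imp_inj_on) auto
  then have "r d = r e"
    by (rule inj_onD) (simp_all add: r eq)
  then show ?thesis
    using j unfolding r_def by (metis restrict_apply')
qed

text \<open>
  An element of the subgroup that omits \<open>a j\<close> has a presentation whose \<open>j\<close>-th exponent is zero.
  Since exponents are unique modulo \<open>k\<close>, a common element has all exponents divisible by \<open>k\<close>.
\<close>

lemma (in comm_group) homocyclic_omit_inter_trivial:
  fixes a :: "'i \<Rightarrow> 'a"
  assumes fin: "finite I" and a: "a \<in> I \<rightarrow> carrier G" and gen: "carrier G = generate G (a ` I)"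
    and k: "k > 0" and exponent: "\<And>x. x \<in> carrier G \<Longrightarrow> x [^] k = \<one>"
    and card: "card (carrier G) = k ^ card I"
    and x: "x \<in> carrier G" "\<And>j. j \<in> I \<Longrightarrow> x \<in> generate G (a ` (I - {j}))"
  shows "x = \<one>"
proof -
  obtain e :: "'i \<Rightarrow> int" where e: "x = (\<Otimes>i\<in>I. a i [^] e i)"
    using x(1) unfolding gen generate_eq_finprod_int_pow[OF fin a] by auto
  have mod_zero: "e j mod int k = 0" if j: "j \<in> I" for j
  proof -
    obtain d :: "'i \<Rightarrow> int" where d: "d j = 0" "x = (\<Otimes>i\<in>I. a i [^] d i)"
      using x(2)[OF j] unfolding generate_omit_eq_finprod_int_pow[OF fin a j] by blast
    then show ?thesis
      using homocyclic_exponents_unique[OF fin a gen k exponent card _ j, of d e] e by simp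
  qed
  have "a i [^] e i = \<one>" if i: "i \<in> I" for i
  proof -
    have ai: "a i \<in> carrier G" using a i by auto
    have "int (ord (a i)) dvd int k"
      using exponent[OF ai] pow_eq_id[OF ai] by simp
    moreover have "int k dvd e i"
      using mod_zero[OF i] by presburger
    ultimately show ?thesis
      using int_pow_eq_id[OF ai] dvd_trans by blast
  qed
  then show ?thesis
    unfolding e by (simp add: finprod_one_eqI)
qed

text \<open>
  Applied to automorphisms: the inverses come from the isomorphism, so that it need not be shown
  that the inverse of a conformal automorphism, in the sense of its charts, is again one.
\<close>

lemma monoid_iso_group_imp_group:
  assumes "monoid G" and "group P" and iso: "G \<cong> P"
  shows "group G"
proof -
  interpret monoid G by fact
  interpret P: group P by fact
  obtain \<phi> where \<phi>: "\<phi> \<in> Group.iso G P"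
    using iso unfolding is_iso_def by auto
  then have bij: "bij_betw \<phi> (carrier G) (carrier P)" and hom: "\<phi> \<in> hom G P"
    by (auto simp: Group.iso_def)
  have closed: "\<phi> x \<in> carrier P" if "x \<in> carrier G" for x
    using bij that by (rule bij_betw_apply)
  have one: "\<phi> \<one>\<^bsub>G\<^esub> = \<one>\<^bsub>P\<^esub>"
    using hom_mult[OF hom one_closed one_closed] closed[OF one_closed] by simp
  show ?thesis
  proof (rule groupI)
    fix x assume x: "x \<in> carrier G"
    have "inv\<^bsub>P\<^esub> \<phi> x \<in> \<phi> ` carrier G"
      using bij_betw_imp_surj_on[OF bij] closed[OF x] by simp
    then obtain y where y: "y \<in> carrier G" "\<phi> y = inv\<^bsub>P\<^esub> \<phi> x"
      by auto
    then have "\<phi> (y \<otimes>\<^bsub>G\<^esub> x) = \<phi> \<one>\<^bsub>G\<^esub>"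
      using x by (simp add: hom_mult[OF hom] closed one)
    then have "y \<otimes>\<^bsub>G\<^esub> x = \<one>\<^bsub>G\<^esub>"
      using bij x y by (auto simp: bij_betw_def dest: inj_onD)
    then show "\<exists>y \<in> carrier G. y \<otimes>\<^bsub>G\<^esub> x = \<one>\<^bsub>G\<^esub>"
      using y by blast
  qed (auto simp: m_assoc)
qed

lemma iso_integer_mod_power:
  assumes "monoid G" and iso: "G \<cong> product_group I (\<lambda>_. integer_mod_group k)"
    and fin: "finite I" and k: "k > 0"
  shows "comm_group G" and "card (carrier G) = k ^ card I"
    and "\<And>x. x \<in> carrier G \<Longrightarrow> x [^]\<^bsub>G\<^esub> k = \<one>\<^bsub>G\<^esub>"
proof -
  let ?P = "product_group I (\<lambda>_. integer_mod_group k)"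
  have P: "group ?P" by simp
  interpret group G
    using monoid_iso_group_imp_group[OF assms(1) P iso] .
  obtain \<phi> where \<phi>: "\<phi> \<in> Group.iso G ?P"
    using iso unfolding is_iso_def by auto
  then have bij: "bij_betw \<phi> (carrier G) (carrier ?P)" and hom: "\<phi> \<in> hom G ?P"
    by (auto simp: Group.iso_def)
  have inj: "x = y" if "\<phi> x = \<phi> y" "x \<in> carrier G" "y \<in> carrier G" for x y
    using bij that by (auto simp: bij_betw_def dest: inj_onD)
  show "comm_group G"
  proof (rule group_comm_groupI)
    fix x y assume xy: "x \<in> carrier G" "y \<in> carrier G"
    have "\<phi> (x \<otimes>\<^bsub>G\<^esub> y) = \<phi> (y \<otimes>\<^bsub>G\<^esub> x)"
      by (simp only: hom_mult[OF hom xy] hom_mult[OF hom xy(2,1)] mult_product_group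
          mult_integer_mod_group add.commute)
    then show "x \<otimes>\<^bsub>G\<^esub> y = y \<otimes>\<^bsub>G\<^esub> x"
      using inj xy by simp
  qed
  show "card (carrier G) = k ^ card I"
    using bij_betw_same_card[OF bij] fin k by (simp add: card_PiE carrier_integer_mod_group)
  show "x [^]\<^bsub>G\<^esub> k = \<one>\<^bsub>G\<^esub>" if x: "x \<in> carrier G" for x
  proof (rule inj)
    have pow: "y [^]\<^bsub>?P\<^esub> m = (\<lambda>i\<in>I. y i [^]\<^bsub>integer_mod_group k\<^esub> m)" for y and m :: nat
    proof (induction m)
      case 0
      show ?case by (simp add: restrict_def)
    next
      case (Suc m)
      show ?case
        unfolding Group.nat_pow_Suc Suc.IH mult_product_group
        by (rule restrict_ext) (simp only: restrict_apply' Group.nat_pow_Suc)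
    qed
    have "\<phi> x [^]\<^bsub>?P\<^esub> k = \<one>\<^bsub>?P\<^esub>"
      unfolding pow by (simp add: restrict_def fun_eq_iff)
    then show "\<phi> (x [^]\<^bsub>G\<^esub> k) = \<phi> \<one>\<^bsub>G\<^esub>"
      by (simp only: hom_nat_pow[OF hom x is_group P] hom_one[OF hom is_group P])
  qed (use x in auto)
qed

section \<open>Charts and local homeomorphisms\<close>

lemma coordinate_chart_inj_on:
  assumes "coordinate_chart T U f"
  shows "inj_on f U"
proof -
  have "topspace (subtopology T U) = U"
    using assms openin_subset unfolding coordinate_chart_def
    by (auto simp: topspace_subtopology_subset)
  then show ?thesis
    using assms unfolding coordinate_chart_def homeomorphic_map_def by simp
qed

lemma coordinate_chart_open_image:
  assumes chart: "coordinate_chart T U f" and W: "openin T W" "W \<subseteq> U"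
  shows "open (f ` W)"
proof -
  have U: "openin T U" "open (f ` U)"
    and hom: "homeomorphic_map (subtopology T U) (top_of_set (f ` U)) f"
    using chart unfolding coordinate_chart_def by auto
  have top: "topspace (subtopology T U) = U"
    using U openin_subset by (auto simp: topspace_subtopology_subset)
  have "openin (subtopology T U) W"
    using W U by (simp add: openin_open_subtopology)
  then have "openin (top_of_set (f ` U)) (f ` W)"
    using homeomorphic_map_openness[OF hom] W top by blast
  then show ?thesis
    using U by (simp add: openin_open_eq)
qed

lemma coordinate_chart_comp:
  assumes chart: "coordinate_chart T' U f" and W: "openin T W" and "p ` W \<subseteq> U"
    and pW: "openin T' (p ` W)"
    and hom: "homeomorphic_map (subtopology T W) (subtopology T' (p ` W)) p"
  shows "coordinate_chart T W (f \<circ> p)"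
proof -
  have U: "openin T' U" and f: "homeomorphic_map (subtopology T' U) (top_of_set (f ` U)) f"
    using chart unfolding coordinate_chart_def by auto
  have "topspace T' \<inter> U = U" "U \<inter> p ` W = p ` W" "topspace T' \<inter> (U \<inter> p ` W) = p ` W"
    using \<open>p ` W \<subseteq> U\<close> openin_subset[OF U] openin_subset[OF pW] by auto
  then have "homeomorphic_map (subtopology (subtopology T' U) (p ` W))
      (subtopology (top_of_set (f ` U)) (f ` p ` W)) f"
    using \<open>p ` W \<subseteq> U\<close> by (intro homeomorphic_map_subtopologies[OF f]) auto
  moreover have "subtopology (subtopology T' U) (p ` W) = subtopology T' (p ` W)"
    "subtopology (top_of_set (f ` U)) (f ` p ` W) = top_of_set (f ` p ` W)"
    using \<open>p ` W \<subseteq> U\<close> by (simp_all add: subtopology_subtopology Int_absorb1 image_mono)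
  ultimately have "homeomorphic_map (subtopology T W) (top_of_set (f ` p ` W)) (f \<circ> p)"
    using homeomorphic_map_compose[OF hom] by simp
  then show ?thesis
    using W coordinate_chart_open_image[OF chart pW \<open>p ` W \<subseteq> U\<close>]
    unfolding coordinate_chart_def by (simp add: image_comp)
qed

text \<open>
  The neighbourhood is a sheet over an evenly covered set, cut down to the preimage of \<open>U\<close>.
\<close>

lemma covering_map_local_homeomorphism:
  assumes cov: "covering_map T T' p" and x: "x \<in> topspace T" and U: "openin T' U" "p x \<in> U"
  obtains V where "openin T V" and "x \<in> V" and "p ` V \<subseteq> U" and "openin T' (p ` V)"
    and "homeomorphic_map (subtopology T V) (subtopology T' (p ` V)) p"
proof -
  have cont: "continuous_map T T' p"
    using cov unfolding covering_map_def by auto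
  have "p x \<in> topspace T'"
    using U openin_subset by blast
  then obtain N \<V> where N: "openin T' N" "p x \<in> N" and \<V>: "\<Union>\<V> = {x \<in> topspace T. p x \<in> N}"
    and sheet: "\<And>V. V \<in> \<V> \<Longrightarrow>
      openin T V \<and> homeomorphic_map (subtopology T V) (subtopology T' N) p"
    using cov unfolding covering_map_def by meson
  obtain V where V: "V \<in> \<V>" "x \<in> V"
    using \<V> N x by blast
  define V' where "V' = V \<inter> {x \<in> topspace T. p x \<in> U}"
  have V': "openin T V'"
    unfolding V'_def using sheet[OF V(1)] openin_continuous_map_preimage[OF cont U(1)] by blast
  have "V' \<subseteq> V" unfolding V'_def by auto
  have pV': "p ` V' \<subseteq> N" using \<open>V' \<subseteq> V\<close> V \<V> by blast
  have "homeomorphic_map (subtopology (subtopology T V) V') (subtopology (subtopology T' N) (p ` V')) p"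
  proof (rule homeomorphic_map_subtopologies)
    show "homeomorphic_map (subtopology T V) (subtopology T' N) p"
      using sheet[OF V(1)] by blast
    show "p ` (topspace (subtopology T V) \<inter> V') = topspace (subtopology T' N) \<inter> p ` V'"
      using \<open>V' \<subseteq> V\<close> pV' openin_subset[OF V'] openin_subset[OF N(1)] by auto
  qed
  then have "homeomorphic_map (subtopology T V') (subtopology T' (p ` V')) p"
    using \<open>V' \<subseteq> V\<close> pV' by (simp add: subtopology_subtopology Int_absorb1)
  moreover have "openin T' (p ` V')"
    using covering_map_imp_open_map[OF cov] V' unfolding open_map_def by blast
  moreover have "x \<in> V'" "p ` V' \<subseteq> U"
    using V x U unfolding V'_def by auto
  ultimately show ?thesis
    using V' that by blast
qed

section \<open>The complex structure of the fiber product\<close>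

lemma topspace_fiber_product_top:
  "topspace (fiber_product_top n Y P) = fiber_product_points n Y P"
  unfolding fiber_product_top_def fiber_product_points_def
  by auto

lemma surf_top_fiber_product: "surf_top (fiber_product n Y X P) = fiber_product_top n Y P"
  unfolding fiber_product_def by simp

lemma fiber_product_chartE:
  assumes "(W, q) \<in> surf_charts (fiber_product n Y X P)"
  obtains U f where "q = f \<circ> fiber_product_proj P" and "(U, f) \<in> surf_charts X"
    and "openin (fiber_product_top n Y P) W" and "fiber_product_proj P ` W \<subseteq> U"
    and "openin (surf_top X) (fiber_product_proj P ` W)"
    and "homeomorphic_map (subtopology (fiber_product_top n Y P) W)
      (subtopology (surf_top X) (fiber_product_proj P ` W)) (fiber_product_proj P)"
  using assms unfolding fiber_product_def by auto

lemma fiber_product_chart: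
  assumes "(U, f) \<in> surf_charts X"
    and "openin (fiber_product_top n Y P) W" and "fiber_product_proj P ` W \<subseteq> U"
    and "openin (surf_top X) (fiber_product_proj P ` W)"
    and "homeomorphic_map (subtopology (fiber_product_top n Y P) W)
      (subtopology (surf_top X) (fiber_product_proj P ` W)) (fiber_product_proj P)"
  shows "(W, f \<circ> fiber_product_proj P) \<in> surf_charts (fiber_product n Y X P)"
  using assms unfolding fiber_product_def by auto

lemma fiber_product_coordinate_chart:
  assumes X: "riemann_surface X" and "(W, q) \<in> surf_charts (fiber_product n Y X P)"
  shows "coordinate_chart (fiber_product_top n Y P) W q"
  using assms(2)
proof (rule fiber_product_chartE)
  fix U f assume *: "q = f \<circ> fiber_product_proj P" "(U, f) \<in> surf_charts X"
    "openin (fiber_product_top n Y P) W" "fiber_product_proj P ` W \<subseteq> U"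
    "openin (surf_top X) (fiber_product_proj P ` W)"
    "homeomorphic_map (subtopology (fiber_product_top n Y P) W)
      (subtopology (surf_top X) (fiber_product_proj P ` W)) (fiber_product_proj P)"
  then have "coordinate_chart (surf_top X) U f"
    using X unfolding riemann_surface_def by auto
  then show ?thesis
    unfolding *(1) using * by (intro coordinate_chart_comp)
qed

text \<open>
  The projection cancels: both charts factor through it, so the transition map is a restriction
  of the one between the underlying charts of \<open>X\<close>.
\<close>

lemma fiber_product_transition_holomorphic:
  assumes X: "riemann_surface X"
    and W: "(W, q) \<in> surf_charts (fiber_product n Y X P)"
    and W': "(W', q') \<in> surf_charts (fiber_product n Y X P)"
  shows "(q' \<circ> inv_into W q) holomorphic_on q ` (W \<inter> W')"
proof -
  let ?p = "fiber_product_proj P"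
  obtain U f where q: "q = f \<circ> ?p" and U: "(U, f) \<in> surf_charts X" and WU: "?p ` W \<subseteq> U"
    using W by (rule fiber_product_chartE)
  obtain U' f' where q': "q' = f' \<circ> ?p" and U': "(U', f') \<in> surf_charts X" and WU': "?p ` W' \<subseteq> U'"
    using W' by (rule fiber_product_chartE)
  have chart: "coordinate_chart (surf_top X) U f"
    using X U unfolding riemann_surface_def by auto
  have inj_f: "inj_on f U"
    using chart by (rule coordinate_chart_inj_on)
  have inj_q: "inj_on q W"
    using fiber_product_coordinate_chart[OF X W] by (rule coordinate_chart_inj_on)
  have "(f' \<circ> inv_into U f) holomorphic_on f ` (U \<inter> U')"
    using X U U' unfolding riemann_surface_def by blast
  then have "(f' \<circ> inv_into U f) holomorphic_on q ` (W \<inter> W')"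
    by (rule holomorphic_on_subset) (use WU WU' q in auto)
  then show ?thesis
  proof (rule holomorphic_transform)
    fix z assume "z \<in> q ` (W \<inter> W')"
    then obtain w where w: "w \<in> W" "z = q w" by auto
    have "inv_into W q z = w"
      using w inj_q by simp
    moreover have "inv_into U f z = ?p w"
      unfolding w(2) q using w WU inj_f by (auto intro: inv_into_f_f)
    ultimately show "(f' \<circ> inv_into U f) z = (q' \<circ> inv_into W q) z"
      by (simp add: q')
  qed
qed

lemma fiber_product_Hausdorff:
  assumes "\<And>j. j \<in> {1..n} \<Longrightarrow> Hausdorff_space (surf_top (Y j))"
  shows "Hausdorff_space (fiber_product_top n Y P)"
  unfolding fiber_product_top_def
  using assms by (intro Hausdorff_space_subtopology) (simp add: Hausdorff_space_product_topology)

text \<open>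
  Any continuous bijective lift \<open>\<phi>\<close> of \<open>\<pi>\<close> identifies the two surfaces.  The fiber product only
  has the charts on which its projection is a homeomorphism, so it must be shown that these exist
  near every point: they are the images under \<open>\<phi>\<close> of the neighbourhoods on which \<open>\<pi>\<close> is one.
\<close>

lemma fiber_product_parametrization:
  assumes S: "closed_riemann_surface S" and cov: "holomorphic_covering S X \<pi>"
    and Hausdorff: "\<And>j. j \<in> {1..n} \<Longrightarrow> Hausdorff_space (surf_top (Y j))"
    and cont: "continuous_map (surf_top S) (fiber_product_top n Y P) \<phi>"
    and bij: "bij_betw \<phi> (points S) (fiber_product_points n Y P)"
    and lift: "\<And>x. x \<in> points S \<Longrightarrow> fiber_product_proj P (\<phi> x) = \<pi> x"
  shows "closed_riemann_surface (fiber_product n Y X P)"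
    and "biholomorphic_map S (fiber_product n Y X P) \<phi>"
proof -
  let ?T = "fiber_product_top n Y P" and ?Z = "fiber_product n Y X P"
  let ?p = "fiber_product_proj P"
  have RS: "riemann_surface S" and compact: "compact_space (surf_top S)"
    using S unfolding closed_riemann_surface_def by auto
  have RX: "riemann_surface X" and \<pi>: "holomorphic_map S X \<pi>"
    and covm: "covering_map (surf_top S) (surf_top X) \<pi>"
    using cov unfolding holomorphic_covering_def by auto
  have T: "Hausdorff_space ?T"
    using fiber_product_Hausdorff Hausdorff by blast
  have surj: "\<phi> ` points S = topspace ?T" and inj: "inj_on \<phi> (points S)"
    using bij by (auto simp: bij_betw_def topspace_fiber_product_top)
  have hom: "homeomorphic_map (surf_top S) ?T \<phi>"
    using continuous_imp_homeomorphic_map[OF cont compact T surj inj] .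
  define \<psi> where "\<psi> = inv_into (points S) \<phi>"
  have \<psi>\<phi>: "\<psi> (\<phi> x) = x" if "x \<in> points S" for x
    unfolding \<psi>_def using inj that by simp
  have \<psi>: "\<psi> z \<in> points S" "\<phi> (\<psi> z) = z" if "z \<in> topspace ?T" for z
    unfolding \<psi>_def using surj that by (auto simp: inv_into_into f_inv_into_f)
  have hom\<psi>: "homeomorphic_map ?T (surf_top S) \<psi>"
  proof -
    obtain g where g: "homeomorphic_maps (surf_top S) ?T \<phi> g"
      using hom unfolding homeomorphic_map_maps by blast
    then have "homeomorphic_map ?T (surf_top S) g"
      and "\<And>z. z \<in> topspace ?T \<Longrightarrow> g z \<in> points S \<and> \<phi> (g z) = z"
      unfolding homeomorphic_maps_map using homeomorphic_imp_surjective_map by blast+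
    then show ?thesis
      using \<psi>\<phi> homeomorphic_map_eq by metis
  qed
  have p: "?p z = \<pi> (\<psi> z)" if "z \<in> topspace ?T" for z
    using lift \<psi>[OF that] by metis
  have space: "surf_top S homeomorphic_space ?T"
    using hom by (rule homeomorphic_map_imp_homeomorphic_space)

  \<comment> \<open>The coordinates of the fiber product near \<open>z\<close>: a piece of \<open>S\<close> on which \<open>\<pi>\<close> is a
    homeomorphism is carried over by \<open>\<phi>\<close>.\<close>
  have charts_cover: "\<exists>W q. (W, q) \<in> surf_charts ?Z \<and> z \<in> W" if z: "z \<in> topspace ?T" for z
  proof -
    have x: "\<psi> z \<in> points S" using \<psi> z by blast
    then have "\<pi> (\<psi> z) \<in> points X"
      using covm unfolding covering_map_def by auto
    then obtain U f where U: "(U, f) \<in> surf_charts X" "\<pi> (\<psi> z) \<in> U"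
      using RX unfolding riemann_surface_def by blast
    then have "openin (surf_top X) U"
      using RX unfolding riemann_surface_def coordinate_chart_def by blast
    then obtain V where V: "openin (surf_top S) V" "\<psi> z \<in> V" "\<pi> ` V \<subseteq> U"
      "openin (surf_top X) (\<pi> ` V)"
      and homV: "homeomorphic_map (subtopology (surf_top S) V) (subtopology (surf_top X) (\<pi> ` V)) \<pi>"
      using covering_map_local_homeomorphism[OF covm x _ U(2)] by metis
    have VS: "V \<subseteq> points S" using V openin_subset by blast
    define W where "W = \<phi> ` V"
    have W: "openin ?T W"
      unfolding W_def using homeomorphic_map_openness[OF hom VS] V by simp
    have WT: "W \<subseteq> topspace ?T" using W openin_subset by blast
    have \<psi>W: "\<psi> ` W = V"
      unfolding W_def image_image using VS \<psi>\<phi> by (simp add: subset_iff)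
    have pW: "?p ` W = \<pi> ` V"
      unfolding W_def image_image using VS lift by (simp add: subset_iff)
    have "homeomorphic_map (subtopology ?T W) (subtopology (surf_top S) V) \<psi>"
      using WT VS \<psi>W by (intro homeomorphic_map_subtopologies[OF hom\<psi>]) (simp add: Int_absorb1)
    then have "homeomorphic_map (subtopology ?T W) (subtopology (surf_top X) (\<pi> ` V)) (\<pi> \<circ> \<psi>)"
      using homV by (rule homeomorphic_map_compose)
    then have "homeomorphic_map (subtopology ?T W) (subtopology (surf_top X) (?p ` W)) ?p"
      unfolding pW by (rule homeomorphic_map_eq) (simp add: p)
    then have "(W, f \<circ> ?p) \<in> surf_charts ?Z"
      using U W V pW by (intro fiber_product_chart) auto
    moreover have "z \<in> W"
      unfolding W_def using V(2) \<psi>(2)[OF z] by (metis image_eqI)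
    ultimately show ?thesis by blast
  qed

  have "(\<Union>(W, q) \<in> surf_charts ?Z. W) = topspace ?T"
  proof
    show "(\<Union>(W, q) \<in> surf_charts ?Z. W) \<subseteq> topspace ?T"
      using openin_subset by (fastforce elim: fiber_product_chartE)
    show "topspace ?T \<subseteq> (\<Union>(W, q) \<in> surf_charts ?Z. W)"
      using charts_cover by fastforce
  qed
  moreover have "topspace ?T \<noteq> {}" "connected_space ?T" "compact_space ?T"
    using RS surj compact homeomorphic_connected_space[OF space] homeomorphic_compact_space[OF space]
    unfolding riemann_surface_def by auto
  ultimately show "closed_riemann_surface ?Z"
    unfolding closed_riemann_surface_def riemann_surface_def surf_top_fiber_product
    using T fiber_product_coordinate_chart[OF RX] fiber_product_transition_holomorphic[OF RX]
    by blast

  \<comment> \<open>In the charts of the fiber product, \<open>\<phi>\<close> reads as \<open>\<pi>\<close>.\<close>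
  have read: "(q \<circ> \<phi> \<circ> inv_into V f) holomorphic_on f ` {x \<in> V. \<phi> x \<in> W}"
    if V: "(V, f) \<in> surf_charts S" and W: "(W, q) \<in> surf_charts ?Z" for V f W q
  proof -
    obtain U h where q: "q = h \<circ> ?p" and U: "(U, h) \<in> surf_charts X" and WU: "?p ` W \<subseteq> U"
      using W by (rule fiber_product_chartE)
    have "coordinate_chart (surf_top S) V f"
      using RS V unfolding riemann_surface_def by auto
    then have VS: "V \<subseteq> points S" and inj_f: "inj_on f V"
      using coordinate_chart_inj_on unfolding coordinate_chart_def
      by (auto dest: openin_subset)
    have "(h \<circ> \<pi> \<circ> inv_into V f) holomorphic_on f ` {x \<in> V. \<pi> x \<in> U}"
      using \<pi> V U unfolding holomorphic_map_def by blast
    moreover have "f ` {x \<in> V. \<phi> x \<in> W} \<subseteq> f ` {x \<in> V. \<pi> x \<in> U}"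
      using WU VS lift by (intro image_mono) (force simp: subset_iff)
    ultimately have "(h \<circ> \<pi> \<circ> inv_into V f) holomorphic_on f ` {x \<in> V. \<phi> x \<in> W}"
      by (rule holomorphic_on_subset)
    then show ?thesis
    proof (rule holomorphic_transform)
      fix z assume "z \<in> f ` {x \<in> V. \<phi> x \<in> W}"
      then obtain x where "x \<in> V" "z = f x" by auto
      then show "(h \<circ> \<pi> \<circ> inv_into V f) z = (q \<circ> \<phi> \<circ> inv_into V f) z"
        using inj_f VS lift by (auto simp: q)
    qed
  qed
  have "holomorphic_map S ?Z \<phi>"
    unfolding holomorphic_map_def surf_top_fiber_product using cont read by auto

  moreover have "(f \<circ> \<psi> \<circ> inv_into W q) holomorphic_on q ` {z \<in> W. \<psi> z \<in> V}"
    if V: "(V, f) \<in> surf_charts S" and W: "(W, q) \<in> surf_charts ?Z" for V f W q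
  proof -
    have chart_f: "coordinate_chart (surf_top S) V f"
      using RS V unfolding riemann_surface_def by auto
    have chart_q: "coordinate_chart ?T W q"
      using fiber_product_coordinate_chart[OF RX W] .
    have VS: "openin (surf_top S) V" "V \<subseteq> points S" and WT: "openin ?T W" "W \<subseteq> topspace ?T"
      using chart_f chart_q unfolding coordinate_chart_def by (auto dest: openin_subset)
    have inj_f: "inj_on f V" and inj_q: "inj_on q W"
      using chart_f chart_q by (auto intro: coordinate_chart_inj_on)
    \<comment> \<open>\<open>F\<close> is \<open>\<phi>\<close> read in the two charts; its holomorphic inverse is \<open>\<psi>\<close> read in them.\<close>
    define A where "A = {x \<in> V. \<phi> x \<in> W}"
    define F where "F = q \<circ> \<phi> \<circ> inv_into V f"
    have "A = V \<inter> {x \<in> points S. \<phi> x \<in> W}"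
      unfolding A_def using VS by auto
    then have "openin (surf_top S) A"
      using VS WT openin_continuous_map_preimage[OF cont] by auto
    then have "open (f ` A)"
      using coordinate_chart_open_image[OF chart_f] unfolding A_def by auto
    have F: "F (f x) = q (\<phi> x)" if "x \<in> A" for x
      using that inj_f unfolding F_def A_def by simp
    have inj_F: "inj_on F (f ` A)"
    proof (rule inj_onI)
      fix u v assume "u \<in> f ` A" "v \<in> f ` A" "F u = F v"
      then obtain x y where xy: "x \<in> A" "u = f x" "y \<in> A" "v = f y" by auto
      then have "\<phi> x = \<phi> y"
        using \<open>F u = F v\<close> F inj_q unfolding A_def by (auto dest: inj_onD)
      then show "u = v"
        using xy inj VS unfolding A_def by (auto dest: inj_onD)
    qed
    have hol_F: "F holomorphic_on f ` A"
      unfolding F_def A_def using V W by (rule read)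
    obtain g where g: "g holomorphic_on F ` f ` A"
      and "\<And>u. u \<in> f ` A \<Longrightarrow> deriv F u * deriv g (F u) = 1"
      and gF: "\<And>u. u \<in> f ` A \<Longrightarrow> g (F u) = u"
      by (rule holomorphic_has_inverse[OF hol_F \<open>open (f ` A)\<close> inj_F]) (rule that)
    have A: "\<psi> z \<in> A" if "z \<in> W" "\<psi> z \<in> V" for z
      using that WT \<psi>(2) unfolding A_def by auto
    have "q ` {z \<in> W. \<psi> z \<in> V} \<subseteq> F ` f ` A"
    proof
      fix u assume "u \<in> q ` {z \<in> W. \<psi> z \<in> V}"
      then obtain z where z: "z \<in> W" "\<psi> z \<in> V" "u = q z" by auto
      then have "u = F (f (\<psi> z))"
        using F[OF A] \<psi>(2) WT by auto
      then show "u \<in> F ` f ` A" using A z by blast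
    qed
    with g have "g holomorphic_on q ` {z \<in> W. \<psi> z \<in> V}"
      by (rule holomorphic_on_subset)
    then show ?thesis
    proof (rule holomorphic_transform)
      fix u assume "u \<in> q ` {z \<in> W. \<psi> z \<in> V}"
      then obtain z where z: "z \<in> W" "\<psi> z \<in> V" "u = q z" by auto
      then have "u = F (f (\<psi> z))"
        using F[OF A] \<psi>(2) WT by auto
      then have "g u = f (\<psi> z)"
        using gF A z by auto
      then show "g u = (f \<circ> \<psi> \<circ> inv_into W q) u"
        using z inj_q by simp
    qed
  qed
  then have "holomorphic_map ?Z S \<psi>"
    unfolding holomorphic_map_def surf_top_fiber_product
    using hom\<psi> homeomorphic_imp_continuous_map by auto
  ultimately show "biholomorphic_map S ?Z \<phi>"
    unfolding biholomorphic_map_def surf_top_fiber_product topspace_fiber_product_top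
    using bij \<psi>_def by simp
qed

section \<open>Groups of automorphisms\<close>

text \<open>
  Inverses depend on the carrier, because they are defined by a search through it.  For a carrier
  \<open>C\<close> that need not be a subgroup they are still the right ones on elements of the subgroup \<open>H\<close>.
  This is applied with \<open>C\<close> the set of conformal automorphisms inside all bijections.
\<close>

lemma (in group) generate_restrict_carrier:
  assumes group: "group (G\<lparr>carrier := H\<rparr>)" and HC: "H \<subseteq> C" and C: "C \<subseteq> carrier G" and A: "A \<subseteq> H"
  shows "generate (G\<lparr>carrier := C\<rparr>) A = generate (G\<lparr>carrier := H\<rparr>) A"
proof -
  have sub: "subgroup H G"
    using group HC C by (intro group_incl_imp_subgroup) auto
  have inv': "inv\<^bsub>G\<lparr>carrier := C\<rparr>\<^esub> x = inv x" if x: "x \<in> H" for x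
    unfolding m_inv_def[of "G\<lparr>carrier := C\<rparr>"]
  proof (rule the_equality)
    show "inv x \<in> carrier (G\<lparr>carrier := C\<rparr>) \<and> x \<otimes>\<^bsub>G\<lparr>carrier := C\<rparr>\<^esub> inv x = \<one>\<^bsub>G\<lparr>carrier := C\<rparr>\<^esub>
        \<and> inv x \<otimes>\<^bsub>G\<lparr>carrier := C\<rparr>\<^esub> x = \<one>\<^bsub>G\<lparr>carrier := C\<rparr>\<^esub>"
      using x HC C subgroup.m_inv_closed[OF sub x] by auto
    show "y = inv x" if "y \<in> carrier (G\<lparr>carrier := C\<rparr>) \<and> x \<otimes>\<^bsub>G\<lparr>carrier := C\<rparr>\<^esub> y = \<one>\<^bsub>G\<lparr>carrier := C\<rparr>\<^esub>
        \<and> y \<otimes>\<^bsub>G\<lparr>carrier := C\<rparr>\<^esub> x = \<one>\<^bsub>G\<lparr>carrier := C\<rparr>\<^esub>" for y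
    proof -
      have "y \<otimes> x = \<one>" "y \<in> carrier G" "x \<in> carrier G"
        using that x HC C by auto
      then show ?thesis using inv_equality by metis
    qed
  qed
  have "generate (G\<lparr>carrier := C\<rparr>) A = generate G A"
  proof (intro equalityI subsetI)
    show "x \<in> generate G A" if "x \<in> generate (G\<lparr>carrier := C\<rparr>) A" for x
      using that
    proof induction
      case (inv h)
      then have "inv h \<in> generate G A" by (rule generate.inv)
      then show ?case using inv' inv.hyps A by auto
    qed (use generate.one[of G] in \<open>auto intro: generate.incl generate.eng\<close>)
    show "x \<in> generate (G\<lparr>carrier := C\<rparr>) A" if "x \<in> generate G A" for x
      using that
    proof induction
      case one
      show ?case using generate.one[of "G\<lparr>carrier := C\<rparr>"] by simp
    next
      case (inv h)
      then show ?case using generate.inv[of h A "G\<lparr>carrier := C\<rparr>"] inv' A by auto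
    next
      case (eng x y)
      then show ?case using generate.eng[of x "G\<lparr>carrier := C\<rparr>" A y] by simp
    qed (auto intro: generate.incl)
  qed
  then show ?thesis
    using generate_consistent[OF A sub] by simp
qed

lemma carrier_Aut_subset: "carrier (Aut S) \<subseteq> Bij (points S)"
  unfolding Aut_def by auto

lemma Aut_subgroup_restrict:
  assumes "subgroup H (Aut S)"
  shows "(Aut S)\<lparr>carrier := H\<rparr> = (BijGroup (points S))\<lparr>carrier := H\<rparr>"
  unfolding Aut_def by simp

lemma Aut_apply:
  assumes "h \<in> carrier (Aut S)" "h' \<in> carrier (Aut S)" "x \<in> points S"
  shows "(h \<otimes>\<^bsub>Aut S\<^esub> h') x = h (h' x)" and "h x \<in> points S"
proof -
  have "h \<in> Bij (points S)" "h' \<in> Bij (points S)"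
    using assms carrier_Aut_subset by blast+
  then show "(h \<otimes>\<^bsub>Aut S\<^esub> h') x = h (h' x)" and "h x \<in> points S"
    using assms(3) Bij_imp_funcset unfolding Aut_def
    by (auto simp: BijGroup_def compose_def)
qed

lemma monoid_Aut_subgroup:
  assumes H: "subgroup H (Aut S)"
  shows "monoid ((Aut S)\<lparr>carrier := H\<rparr>)"
proof -
  interpret B: group "BijGroup (points S)" by (rule group_BijGroup)
  have "H \<subseteq> carrier (BijGroup (points S))"
    using subgroup.subset[OF H] carrier_Aut_subset unfolding BijGroup_def by auto
  then show ?thesis
    using subgroup.m_closed[OF H] subgroup.one_closed[OF H]
    unfolding Aut_def by (intro monoidI) (auto simp: B.m_assoc subset_iff)
qed

lemma generate_Aut:
  assumes H: "subgroup H (Aut S)" and "group ((Aut S)\<lparr>carrier := H\<rparr>)" and "A \<subseteq> H"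
  shows "generate (Aut S) A = generate ((Aut S)\<lparr>carrier := H\<rparr>) A"
proof -
  interpret B: group "BijGroup (points S)" by (rule group_BijGroup)
  have Aut: "Aut S = (BijGroup (points S))\<lparr>carrier := carrier (Aut S)\<rparr>"
    unfolding Aut_def by simp
  have "carrier (Aut S) \<subseteq> carrier (BijGroup (points S))"
    using carrier_Aut_subset by (simp add: BijGroup_def)
  then have "generate ((BijGroup (points S))\<lparr>carrier := carrier (Aut S)\<rparr>) A
      = generate ((BijGroup (points S))\<lparr>carrier := H\<rparr>) A"
    using assms subgroup.subset[OF H] unfolding Aut_subgroup_restrict[OF H]
    by (intro B.generate_restrict_carrier)
  then show ?thesis
    unfolding Aut_subgroup_restrict[OF H] using Aut by simp
qed

text \<open>
  The element \<open>inv h' \<otimes> h\<close> has a fixed point.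
\<close>

lemma free_action_unique:
  assumes H: "subgroup H (Aut S)" and group: "group ((Aut S)\<lparr>carrier := H\<rparr>)" and free: "acts_freely S H"
    and h: "h \<in> H" "h' \<in> H" and x: "x \<in> points S" and eq: "h x = h' x"
  shows "h = h'"
proof -
  let ?G = "(Aut S)\<lparr>carrier := H\<rparr>"
  interpret group ?G by fact
  have sub: "H \<subseteq> carrier (Aut S)" using H by (rule subgroup.subset)
  let ?i = "inv\<^bsub>?G\<^esub> h'"
  have i: "?i \<in> H" using inv_closed h by auto
  have mult: "(u \<otimes>\<^bsub>?G\<^esub> v) x = u (v x)" if "u \<in> H" "v \<in> H" for u v
    using Aut_apply[of u S v x] that x sub by auto
  have "(?i \<otimes>\<^bsub>?G\<^esub> h) x = (?i \<otimes>\<^bsub>?G\<^esub> h') x"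
    using mult i h eq by simp
  also have "\<dots> = \<one>\<^bsub>?G\<^esub> x"
    using l_inv[of h'] h by simp
  also have "\<dots> = x"
    using x unfolding Aut_def BijGroup_def by simp
  finally have "?i \<otimes>\<^bsub>?G\<^esub> h = \<one>\<^bsub>?G\<^esub>"
    using free x m_closed[of ?i h] i h unfolding acts_freely_def by auto
  then have "inv\<^bsub>?G\<^esub> h = ?i"
    using inv_equality[of ?i h] h i by simp
  then have "inv\<^bsub>?G\<^esub> (inv\<^bsub>?G\<^esub> h) = inv\<^bsub>?G\<^esub> ?i"
    by (rule arg_cong)
  moreover have "h \<in> carrier ?G" "h' \<in> carrier ?G"
    using h by simp_all
  ultimately show ?thesis
    by (simp only: inv_inv)
qed

section \<open>Fermat pairs as fiber products\<close>

theorem theorem2: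
  fixes g k :: nat
    and S :: "'a surface" and H :: "('a \<Rightarrow> 'a) set"
    and X :: "'c surface" and \<pi> :: "'a \<Rightarrow> 'c"
    and a :: "nat \<Rightarrow> 'a \<Rightarrow> 'a" and K :: "nat \<Rightarrow> ('a \<Rightarrow> 'a) set"
    and Y :: "nat \<Rightarrow> 'b surface"
    and Q :: "nat \<Rightarrow> 'a \<Rightarrow> 'b" and P :: "nat \<Rightarrow> 'b \<Rightarrow> 'c"
  assumes "g \<ge> 2" and "k \<ge> 2"
    and "fermat_pair g k S H"
    and "galois_covering S X \<pi> H"
    and "H = generate (Aut S) (a ` {1..2 * g})"
    and "\<And>j. j \<in> {1..2 * g} \<Longrightarrow> K j = generate (Aut S) (a ` ({1..2 * g} - {j}))"
    and "\<And>j. j \<in> {1..2 * g} \<Longrightarrow> galois_covering S (Y j) (Q j) (K j)"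
    and "\<And>j. j \<in> {1..2 * g} \<Longrightarrow>
           cyclic_covering k (Y j) X (P j) (quotient_action S H (Y j) (Q j))"
    and "\<And>j x. j \<in> {1..2 * g} \<Longrightarrow> x \<in> points S \<Longrightarrow> \<pi> x = P j (Q j x)"
  shows "is_fiber_product S H (2 * g) Y X P"
proof -
  define n where "n = 2 * g"
  define I where "I = {1..n}"
  have I: "finite I" "1 \<in> I"
    using \<open>g \<ge> 2\<close> by (auto simp: I_def n_def)
  have k: "k > 0" using \<open>k \<ge> 2\<close> by simp
  let ?G = "(Aut S)\<lparr>carrier := H\<rparr>"
  have S: "closed_riemann_surface S" and H: "subgroup H (Aut S)" and free: "acts_freely S H"
    and iso: "?G \<cong> product_group I (\<lambda>_. integer_mod_group k)"
    using \<open>fermat_pair g k S H\<close> unfolding fermat_pair_def I_def n_def by auto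
  have HAut: "H \<subseteq> carrier (Aut S)" using H by (rule subgroup.subset)
  note homocyclic = iso_integer_mod_power[OF monoid_Aut_subgroup[OF H] iso I(1) k]
  interpret G: comm_group ?G by (rule homocyclic)

  have aH: "a ` I \<subseteq> H"
    using \<open>H = generate (Aut S) (a ` {1..2 * g})\<close> by (auto simp: I_def n_def intro: generate.incl)
  have a: "a \<in> I \<rightarrow> carrier ?G" using aH by auto
  have gen: "carrier ?G = generate ?G (a ` I)"
    using generate_Aut[OF H G.is_group aH] \<open>H = generate (Aut S) (a ` {1..2 * g})\<close>
    by (simp add: I_def n_def)
  have K: "K j = generate ?G (a ` (I - {j}))" if "j \<in> I" for j
    using generate_Aut[OF H G.is_group, of "a ` (I - {j})"] assms(6)[of j] aH that
    by (auto simp: I_def n_def)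
  have KH: "K j \<subseteq> H" if "j \<in> I" for j
    using G.generate_incl[of "a ` (I - {j})"] K[OF that] aH by auto
  have mult: "(h \<otimes>\<^bsub>?G\<^esub> h') x = h (h' x)" if "h \<in> H" "h' \<in> H" "x \<in> points S" for h h' x
    using Aut_apply(1)[of h S h' x] that HAut by auto
  have closed: "h x \<in> points S" if "h \<in> H" "x \<in> points S" for h x
    using Aut_apply(2)[of h S h x] that HAut by auto

  have cov: "holomorphic_covering S X \<pi>" and \<pi>H: "\<And>h x. h \<in> H \<Longrightarrow> x \<in> points S \<Longrightarrow> \<pi> (h x) = \<pi> x"
    and \<pi>trans: "\<And>x y. x \<in> points S \<Longrightarrow> y \<in> points S \<Longrightarrow> \<pi> x = \<pi> y \<Longrightarrow> \<exists>h \<in> H. h x = y"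
    using \<open>galois_covering S X \<pi> H\<close> unfolding galois_covering_def deck_group_def by auto
  have covQ: "holomorphic_covering S (Y j) (Q j)"
    and QK: "\<And>c x. c \<in> K j \<Longrightarrow> x \<in> points S \<Longrightarrow> Q j (c x) = Q j x"
    and Qtrans: "\<And>x y. x \<in> points S \<Longrightarrow> y \<in> points S \<Longrightarrow> Q j x = Q j y \<Longrightarrow> \<exists>c \<in> K j. c x = y"
    if "j \<in> I" for j
    using assms(7)[of j] that unfolding galois_covering_def deck_group_def I_def n_def by auto
  have Q_surj: "Q j ` points S = points (Y j)" and Q_cont: "continuous_map (surf_top S) (surf_top (Y j)) (Q j)"
    and Y_Hausdorff: "Hausdorff_space (surf_top (Y j))" if "j \<in> I" for j
    using covQ[OF that]
    unfolding holomorphic_covering_def covering_map_def riemann_surface_def by auto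
  have Q_points: "Q j x \<in> points (Y j)" if "j \<in> I" "x \<in> points S" for j x
    using Q_surj that by blast
  have deck: "deck_group (Y j) (P j) = quotient_action S H (Y j) (Q j)"
    and Ptrans: "\<And>y z. y \<in> points (Y j) \<Longrightarrow> z \<in> points (Y j) \<Longrightarrow> P j y = P j z \<Longrightarrow>
      \<exists>c \<in> quotient_action S H (Y j) (Q j). c y = z"
    if "j \<in> I" for j
    using assms(8)[of j] that unfolding cyclic_covering_def galois_covering_def I_def n_def by auto
  have PQ: "P j (Q j x) = \<pi> x" if "j \<in> I" "x \<in> points S" for j x
    using assms(9)[of j x] that by (simp add: I_def n_def)

  \<comment> \<open>Surjectivity of the map from \<open>H\<close> to the product of the quotients, in geometric form.\<close>
  have simultaneous: "\<exists>h' \<in> H. \<forall>j \<in> I. \<forall>x \<in> points S. Q j (h' x) = Q j (h j x)"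
    if h: "\<And>j. j \<in> I \<Longrightarrow> h j \<in> H" for h
  proof -
    have "h j \<in> generate ?G (a ` I)" if "j \<in> I" for j
      using h[OF that] gen by auto
    then obtain h' where h': "h' \<in> generate ?G (a ` I)"
      and c: "\<And>j. j \<in> I \<Longrightarrow> \<exists>c \<in> generate ?G (a ` (I - {j})). h' = c \<otimes>\<^bsub>?G\<^esub> h j"
      using G.exists_common_coset_representative[OF I(1) a, of h] by blast
    have "Q j (h' x) = Q j (h j x)" if jx: "j \<in> I" "x \<in> points S" for j x
    proof -
      obtain c where "c \<in> K j" "h' = c \<otimes>\<^bsub>?G\<^esub> h j"
        using c[OF jx(1)] K[OF jx(1)] by auto
      moreover have "c \<in> H" using \<open>c \<in> K j\<close> KH[OF jx(1)] by blast
      ultimately show ?thesis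
        using mult[of c "h j" x] h[OF jx(1)] closed QK[OF jx(1)] jx by auto
    qed
    then show ?thesis
      using h' gen by auto
  qed

  define \<phi> where "\<phi> x = (\<lambda>j\<in>I. Q j x)" for x
  let ?Z = "fiber_product_points n Y P"
  have \<phi>Z: "\<phi> x \<in> ?Z" if "x \<in> points S" for x
    using that Q_points PQ unfolding fiber_product_points_def \<phi>_def I_def by (auto simp: PiE_iff)
  have inj: "inj_on \<phi> (points S)"
  proof (rule inj_onI)
    fix x y assume x: "x \<in> points S" and y: "y \<in> points S" and eq: "\<phi> x = \<phi> y"
    have "\<exists>c \<in> K j. c x = y" if "j \<in> I" for j
      using Qtrans[OF that x y] eq that unfolding \<phi>_def by (metis restrict_apply')
    then obtain c where c: "\<And>j. j \<in> I \<Longrightarrow> c j \<in> K j \<and> c j x = y" by metis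
    \<comment> \<open>By freeness a single element of \<open>H\<close> moves \<open>x\<close> to \<open>y\<close>, so it lies in every \<open>K j\<close>.\<close>
    have "c j = c 1" if "j \<in> I" for j
      using free_action_unique[OF H G.is_group free _ _ x, of "c j" "c 1"] c I KH that by auto
    then have all: "c 1 \<in> K j" if "j \<in> I" for j
      using c that by metis
    have "c 1 = \<one>\<^bsub>?G\<^esub>"
    proof (rule G.homocyclic_omit_inter_trivial[OF I(1) a gen k homocyclic(3,2)])
      show "c 1 \<in> carrier ?G" using all[OF I(2)] KH[OF I(2)] by auto
      show "c 1 \<in> generate ?G (a ` (I - {j}))" if "j \<in> I" for j
        using all[OF that] K[OF that] by simp
    qed
    then show "x = y"
      using c[OF I(2)] x unfolding Aut_def BijGroup_def by simp
  qed
  have surj: "\<exists>x \<in> points S. z = \<phi> x" if z: "z \<in> ?Z" for z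
  proof -
    have zY: "z j \<in> points (Y j)" if "j \<in> I" for j
      using z that unfolding fiber_product_points_def I_def by auto
    have zP: "P i (z i) = P j (z j)" if "i \<in> I" "j \<in> I" for i j
      using z that unfolding fiber_product_points_def I_def by blast
    have "\<exists>x \<in> points S. Q j x = z j" if "j \<in> I" for j
      using zY[OF that] Q_surj[OF that] by (metis imageE)
    then obtain x where x: "\<And>j. j \<in> I \<Longrightarrow> x j \<in> points S \<and> Q j (x j) = z j" by metis
    have "\<exists>h \<in> H. h (x 1) = x j" if "j \<in> I" for j
      using \<pi>trans[of "x 1" "x j"] x I(2) that PQ zP by metis
    then obtain h where h: "\<And>j. j \<in> I \<Longrightarrow> h j \<in> H \<and> h j (x 1) = x j" by metis
    then obtain h' where h': "h' \<in> H" "\<And>j. j \<in> I \<Longrightarrow> Q j (h' (x 1)) = Q j (h j (x 1))"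
      using simultaneous[of h] x I(2) by blast
    have "z = \<phi> (h' (x 1))"
    proof (rule PiE_ext)
      show "z \<in> (\<Pi>\<^sub>E j\<in>I. points (Y j))"
        using z unfolding fiber_product_points_def I_def by auto
      show "\<phi> (h' (x 1)) \<in> (\<Pi>\<^sub>E j\<in>I. points (Y j))"
        using \<phi>Z closed h' x I(2) unfolding fiber_product_points_def I_def by auto
      show "z j = \<phi> (h' (x 1)) j" if "j \<in> I" for j
        using h'(2) h x that unfolding \<phi>_def by simp
    qed
    then show ?thesis
      using closed h' x I(2) by blast
  qed
  have bij: "bij_betw \<phi> (points S) ?Z"
    unfolding bij_betw_def using inj \<phi>Z surj by auto
  have cont: "continuous_map (surf_top S) (fiber_product_top n Y P) \<phi>"
    unfolding fiber_product_top_def continuous_map_in_subtopology continuous_map_componentwise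
    using Q_cont \<phi>Z by (auto simp: \<phi>_def I_def)
  have lift: "fiber_product_proj P (\<phi> x) = \<pi> x" if "x \<in> points S" for x
    using PQ[OF I(2) that] I(2) unfolding fiber_product_proj_def \<phi>_def by simp
  have "closed_riemann_surface (fiber_product n Y X P)"
    and biholo: "biholomorphic_map S (fiber_product n Y X P) \<phi>"
    using fiber_product_parametrization[OF S cov _ cont bij lift] Y_Hausdorff
    unfolding I_def by blast+

  define conj where "conj h = (\<lambda>z\<in>?Z. \<phi> (h (inv_into (points S) \<phi> z)))" for h
  have conj: "conj h = (\<lambda>z\<in>?Z. \<lambda>j\<in>{1..n}. c j (z j))"
    if c: "\<And>j x. j \<in> I \<Longrightarrow> x \<in> points S \<Longrightarrow> c j (Q j x) = Q j (h x)" for h c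
  proof -
    have "\<phi> (h (inv_into (points S) \<phi> z)) = (\<lambda>j\<in>{1..n}. c j (z j))"
      if z: "z \<in> ?Z" for z
    proof -
      obtain x where x: "x \<in> points S" "z = \<phi> x" using surj[OF z] by blast
      have "\<phi> (h x) = (\<lambda>j\<in>{1..n}. c j (z j))"
        unfolding x(2) \<phi>_def using c x(1) by (auto simp: I_def intro!: restrict_ext)
      then show ?thesis
        using x inj by simp
    qed
    then show ?thesis
      unfolding conj_def by (intro restrict_ext)
  qed
  \<comment> \<open>Choose a deck transformation of \<open>P j\<close> that agrees with \<open>h\<close> over one point \<open>x0\<close>.  It is induced
    by some \<open>h'\<close>, and by freeness \<open>h\<close> and \<open>h'\<close> differ by an element of \<open>K j\<close>, so they agree
    everywhere.  This avoids checking by hand that the map induced by \<open>h\<close> is holomorphic.\<close>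
  have descend: "\<exists>c \<in> deck_group (Y j) (P j). \<forall>x \<in> points S. c (Q j x) = Q j (h x)"
    if j: "j \<in> I" and h: "h \<in> H" for j h
  proof -
    obtain x0 where x0: "x0 \<in> points S"
      using S unfolding closed_riemann_surface_def riemann_surface_def by blast
    have "P j (Q j x0) = P j (Q j (h x0))"
      using PQ j h x0 closed \<pi>H by simp
    then obtain c where c: "c \<in> quotient_action S H (Y j) (Q j)" "c (Q j x0) = Q j (h x0)"
      using Ptrans[OF j] Q_surj[OF j] x0 closed[OF h x0] by blast
    then obtain h' where h': "h' \<in> H" "\<And>x. x \<in> points S \<Longrightarrow> c (Q j x) = Q j (h' x)"
      unfolding quotient_action_def by auto
    obtain d where d: "d \<in> K j" "d (h' x0) = h x0"
      using Qtrans[OF j, of "h' x0" "h x0"] closed x0 h h' c by metis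
    then have "(d \<otimes>\<^bsub>?G\<^esub> h') x0 = h x0"
      using mult KH[OF j] h' x0 by auto
    then have "h = d \<otimes>\<^bsub>?G\<^esub> h'"
      using free_action_unique[OF H G.is_group free, of "d \<otimes>\<^bsub>?G\<^esub> h'" h x0] h h' d KH[OF j] x0
        G.m_closed[of d h'] by auto
    then have "Q j (h x) = Q j (h' x)" if "x \<in> points S" for x
      using mult[of d h' x] d KH[OF j] h' that QK[OF j] closed by auto
    then show ?thesis
      using c h' deck[OF j] by auto
  qed
  have "conj ` H = fiber_product_group n Y P"
  proof (intro equalityI subsetI)
    fix u assume "u \<in> conj ` H"
    then obtain h where h: "h \<in> H" "u = conj h" by auto
    have "\<forall>j \<in> I. \<exists>c. c \<in> deck_group (Y j) (P j) \<and> (\<forall>x \<in> points S. c (Q j x) = Q j (h x))"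
      using descend h(1) by blast
    from bchoice[OF this] obtain c
      where c: "\<forall>j \<in> I. c j \<in> deck_group (Y j) (P j) \<and> (\<forall>x \<in> points S. c j (Q j x) = Q j (h x))" ..
    have "u = (\<lambda>z\<in>?Z. \<lambda>j\<in>{1..n}. restrict c I j (z j))"
      unfolding h(2) using c by (intro conj) auto
    moreover have "restrict c I \<in> (\<Pi>\<^sub>E j\<in>{1..n}. deck_group (Y j) (P j))"
      using c by (auto simp: I_def)
    ultimately show "u \<in> fiber_product_group n Y P"
      unfolding fiber_product_group_def by blast
  next
    fix u assume "u \<in> fiber_product_group n Y P"
    then obtain c where c: "c \<in> (\<Pi>\<^sub>E j\<in>{1..n}. deck_group (Y j) (P j))"
      and u: "u = (\<lambda>z\<in>?Z. \<lambda>j\<in>{1..n}. c j (z j))"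
      unfolding fiber_product_group_def by auto
    have "\<exists>h. h \<in> H \<and> (\<forall>x \<in> points S. c j (Q j x) = Q j (h x))" if j: "j \<in> I" for j
    proof -
      have "c j \<in> quotient_action S H (Y j) (Q j)"
        using c j deck[OF j] by (auto simp: PiE_iff I_def)
      then show ?thesis unfolding quotient_action_def by blast
    qed
    then have "\<forall>j \<in> I. \<exists>h. h \<in> H \<and> (\<forall>x \<in> points S. c j (Q j x) = Q j (h x))" by blast
    from bchoice[OF this] obtain h
      where h: "\<forall>j \<in> I. h j \<in> H \<and> (\<forall>x \<in> points S. c j (Q j x) = Q j (h j x))" ..
    then obtain h' where h': "h' \<in> H" "\<And>j x. j \<in> I \<Longrightarrow> x \<in> points S \<Longrightarrow> Q j (h' x) = Q j (h j x)"
      using simultaneous[of h] by blast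
    have "u = conj h'"
      unfolding u using h h' by (intro conj[symmetric]) auto
    then show "u \<in> conj ` H" using h' by blast
  qed
  then have "isomorphic_pairs S H (fiber_product n Y X P) (fiber_product_group n Y P)"
    unfolding isomorphic_pairs_def surf_top_fiber_product topspace_fiber_product_top
    using biholo conj_def by (intro exI[of _ \<phi>]) (auto simp: fun_eq_iff image_def)
  with \<open>closed_riemann_surface (fiber_product n Y X P)\<close> show ?thesis
    unfolding is_fiber_product_def n_def by simp
qed

end
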